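(* Let $\mathbf M$ be a balanced residuated partially ordered semigroup and let $\Omega=\mathcal C_{\mathrm r}(\mathbf M)$ be its residual coherentization. Let $A,B\in\Omega$, $x\in L_A$, $y\in L_B$, put $C=A\vee B$, and let $$\Pi_C(x,y):=\{(xr)(yr):r\in C\}\subseteq L_C .$$ Then $xy$ is the least element of $\Pi_C(x,y)$: $\;xy=\min\Pi_C(x,y)$.
   Context: A residuated partially ordered semigroup is a structure $\mathbf M=\langle M,\le,\cdot,\backslash,/\rangle$ with $\langle M,\le\rangle$ a poset, $\langle M,\cdot\rangle$ a semigroup, and $xy\le z\iff x\le z/y\iff y\le x\backslash z$. An element $p\in M$ is positive if $z\le zp$ and $z\le pz$ for all $z\in M$. $\mathbf M$ is balanced if for every $x\in M$ one has $x\backslash x=x/x$ and this common value is positive; it is then automatically idempotent. Put $\tau(x):=x\backslash x=x/x$. The positive-idempotent skeleton $\operatorname{Sk}(\mathbf M)$ is the set of positive idempotents with the order inherited from $\mathbf M$; it is a join-semilattice in which $u\vee v=uv=vu$. For $A\subseteq S=\operatorname{Sk}(\mathbf M)$ put $L_A:=\{x\in M:\tau(x)\in A\}$. A skeleton partition is a partition of $S$. For $A,B\subseteq S$ put $A\star_\tau B:=\{\tau(xy),\tau(x\backslash y),\tau(x/y): x\in L_A,\ y\in L_B\}$. For a skeleton partition $\Theta$ and $A,B\in\Theta$ put $\operatorname{Out}_\Theta(A,B):=\{C\in\Theta: C\cap(A\star_\tau B)\neq\varnothing\}$; $\Theta$ is $\tau$-residuation-coherent if all sets $\operatorname{Out}_\Theta(A,B)$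 are singletons. For a skeleton partition $\Theta$, form the graph on the blocks of $\Theta$ joining distinct blocks $C,D$ whenever there are $A,B\in\Theta$ with $C,D\in\operatorname{Out}_\Theta(A,B)$; $\operatorname{CC}_{\mathrm r}(\Theta)$ is the partition obtained by merging precisely the blocks lying in the same connected component. Let $\Theta_0=\{\{u\}:u\in S\}$, $\Theta_{n+1}=\operatorname{CC}_{\mathrm r}(\Theta_n)$, let $\equiv_n$ be the equivalence relation of $\Theta_n$, and let $\mathcal C_{\mathrm r}(\mathbf M)$ be the partition of $S$ into the classes of $\bigcup_{n<\omega}\equiv_n$; it is the finest $\tau$-residuation-coherent skeleton partition. For a $\tau$-residuation-coherent $\Omega$, the operation $A\vee B:=$ the $\Omega$-block of $u\vee v$ (any $u\in A$, $v\in B$) is well defined and makes $\Omega$ a join-semilattice. *)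

theory Defs
  imports Main
begin

text \<open>
  The carrier is the whole type. The left residual \<open>lres x z\<close> is the element
  written with a backslash between \<open>x\<close> and \<open>z\<close>, and \<open>rres z y\<close> is \<open>z / y\<close>.
\<close>

class residuated_posemigroup = order + semigroup_mult +
  fixes lres :: "'a \<Rightarrow> 'a \<Rightarrow> 'a"
    and rres :: "'a \<Rightarrow> 'a \<Rightarrow> 'a"
  assumes rres_galois: "x * y \<le> z \<longleftrightarrow> x \<le> rres z y"
    and lres_galois: "x * y \<le> z \<longleftrightarrow> y \<le> lres x z"

definition positive :: "'a::residuated_posemigroup \<Rightarrow> bool" where
  "positive p \<longleftrightarrow> (\<forall>z. z \<le> z * p \<and> z \<le> p * z)"

class balanced_residuated_posemigroup = residuated_posemigroup +
  assumes lres_self_eq_rres_self: "lres x x = rres x x"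
    and positive_lres_self: "z \<le> z * lres x x \<and> z \<le> lres x x * z"

lemma positive_lres_self': "positive (lres x x)"
  for x :: "'a::balanced_residuated_posemigroup"
  by (simp add: positive_def positive_lres_self)

definition tau :: "'a::balanced_residuated_posemigroup \<Rightarrow> 'a" where
  "tau x = lres x x"

lemma tau_eq_rres: "tau x = rres x x"
  by (simp add: tau_def lres_self_eq_rres_self)

definition Sk :: "'a::balanced_residuated_posemigroup set" where
  "Sk = {p. positive p \<and> p * p = p}"

text \<open>The join in the poset \<open>Sk\<close>, i.e. the least upper bound among skeleton elements.\<close>

definition sk_join :: "'a::balanced_residuated_posemigroup \<Rightarrow> 'a \<Rightarrow> 'a" where
  "sk_join u v = (LEAST w. w \<in> Sk \<and> u \<le> w \<and> v \<le> w)"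

definition layer :: "'a::balanced_residuated_posemigroup set \<Rightarrow> 'a set" where
  "layer A = {x. tau x \<in> A}"

definition tau_star ::
  "'a::balanced_residuated_posemigroup set \<Rightarrow> 'a set \<Rightarrow> 'a set" where
  "tau_star A B =
     (\<Union>x\<in>layer A. \<Union>y\<in>layer B. {tau (x * y), tau (lres x y), tau (rres x y)})"

definition Out ::
  "'a::balanced_residuated_posemigroup set set \<Rightarrow> 'a set \<Rightarrow> 'a set \<Rightarrow> 'a set set" where
  "Out \<Theta> A B = {C \<in> \<Theta>. C \<inter> tau_star A B \<noteq> {}}"

definition block_graph ::
  "'a::balanced_residuated_posemigroup set set \<Rightarrow> ('a set \<times> 'a set) set" where
  "block_graph \<Theta> = {(C, D). C \<in> \<Theta> \<and> D \<in> \<Theta> \<and> C \<noteq> D \<and>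
     (\<exists>A\<in>\<Theta>. \<exists>B\<in>\<Theta>. C \<in> Out \<Theta> A B \<and> D \<in> Out \<Theta> A B)}"

text \<open>
  \<open>block_graph\<close> is symmetric, so the connected component of \<open>C\<close> is the set of
  blocks reachable from \<open>C\<close>.
\<close>

definition CC_r ::
  "'a::balanced_residuated_posemigroup set set \<Rightarrow> 'a set set" where
  "CC_r \<Theta> = {\<Union>{D. (C, D) \<in> (block_graph \<Theta>)\<^sup>*} | C. C \<in> \<Theta>}"

primrec Theta :: "nat \<Rightarrow> 'a::balanced_residuated_posemigroup set set" where
  "Theta 0 = {{u} | u. u \<in> Sk}"
| "Theta (Suc n) = CC_r (Theta n)"

definition block_equiv :: "'a set set \<Rightarrow> ('a \<times> 'a) set" where
  "block_equiv \<Theta> = {(u, v). \<exists>X\<in>\<Theta>. u \<in> X \<and> v \<in> X}"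

definition residual_coherentization :: "'a::balanced_residuated_posemigroup set set" where
  "residual_coherentization = Sk // (\<Union>n. block_equiv (Theta n))"

text \<open>
  For a coherent partition the block of \<open>sk_join u v\<close> does not depend on the choice of
  \<open>u \<in> A\<close> and \<open>v \<in> B\<close>, so exactly one block contains all these joins.
\<close>

definition block_join ::
  "'a::balanced_residuated_posemigroup set set \<Rightarrow> 'a set \<Rightarrow> 'a set \<Rightarrow> 'a set" where
  "block_join \<Omega> A B = (THE C. C \<in> \<Omega> \<and> (\<forall>u\<in>A. \<forall>v\<in>B. sk_join u v \<in> C))"

definition Pi_block ::
  "'a::balanced_residuated_posemigroup set \<Rightarrow> 'a \<Rightarrow> 'a \<Rightarrow> 'a set" where
  "Pi_block C x y = {(x * r) * (y * r) | r. r \<in> C}"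

end

theory Submission
  imports Defs "HOL-Library.Disjoint_Sets"
begin

text \<open>
  Any two outputs of the same operations on elements of two given \<open>\<Omega>\<close>-blocks are already produced
  from two common blocks at some finite stage, so they are merged at the next stage; hence \<open>\<Omega>\<close> is
  coherent. Coherence puts \<open>r = tau y'\<close>, where \<open>y' = lres x (x * y)\<close>, into \<open>C\<close>. As \<open>M\<close> is balanced,
  this \<open>r\<close> stabilises \<open>y'\<close> on both sides, so \<open>(x r) (y r) \<le> x (r y' r) \<le> x y' \<le> x y\<close>. The reverse
  inequality holds for every positive \<open>r\<close>.
\<close>

section \<open>Monotone multiplication and positive elements\<close>

lemma mult_left_mono_rp: "a \<le> b \<Longrightarrow> c * a \<le> c * b" for a :: "'a::residuated_posemigroup"
  by (meson lres_galois order_refl order_trans)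

lemma mult_right_mono_rp: "a \<le> b \<Longrightarrow> a * c \<le> b * c" for a :: "'a::residuated_posemigroup"
  by (meson rres_galois order_refl order_trans)

lemma mult_mono_rp: "a \<le> b \<Longrightarrow> c \<le> d \<Longrightarrow> a * c \<le> b * d" for a :: "'a::residuated_posemigroup"
  by (meson mult_left_mono_rp mult_right_mono_rp order_trans)

lemma positive_mult:
  assumes "positive p" "positive q"
  shows "positive (p * q)"
  unfolding positive_def
proof (intro allI conjI)
  fix z
  show "z \<le> z * (p * q)"
    using assms unfolding positive_def mult.assoc[symmetric] by (blast intro: order_trans)
  show "z \<le> p * q * z"
    using assms unfolding positive_def mult.assoc by (blast intro: order_trans)
qed

section \<open>Stabilisers and the skeleton as a join-semilattice\<close>

lemma le_tau_iff_right: "p \<le> tau x \<longleftrightarrow> x * p \<le> x"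
  by (simp add: tau_def lres_galois)

text \<open>Balance enters here: \<open>tau x\<close> is also the right residual of \<open>x\<close>
  by itself, so one element bounds both the left and the right stabilisers of
  \<open>x\<close>.\<close>

lemma le_tau_iff_left: "p \<le> tau x \<longleftrightarrow> p * x \<le> x"
  by (simp add: tau_eq_rres rres_galois)

text \<open>Absorbing \<open>tau x\<close> twice into \<open>x\<close> shows that its square is
  again a right stabiliser, hence below \<open>tau x\<close>; positivity gives the reverse
  inequality.\<close>

lemma tau_in_Sk: "tau x \<in> Sk"
proof -
  have "x * tau x \<le> x"
    using le_tau_iff_right by blast
  then have "x * tau x * tau x \<le> x"
    using mult_right_mono_rp order_trans by blast
  then have "x * (tau x * tau x) \<le> x"
    by (simp add: mult.assoc)
  then have "tau x * tau x \<le> tau x"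
    by (simp add: le_tau_iff_right)
  moreover have "positive (tau x)"
    by (simp add: tau_def positive_lres_self')
  ultimately show ?thesis
    by (simp add: Sk_def positive_def antisym)
qed

text \<open>Idempotence makes \<open>u\<close> a stabiliser of itself, and positivity bounds any
  stabiliser of \<open>u\<close> by \<open>u\<close>. Hence skeleton elements represent their own
  layers.\<close>

lemma tau_Sk: "u \<in> Sk \<Longrightarrow> tau u = u"
proof (rule antisym)
  assume u: "u \<in> Sk"
  then show "u \<le> tau u"
    by (simp add: le_tau_iff_right Sk_def)
  have "tau u \<le> u * tau u"
    using u by (simp add: Sk_def positive_def)
  also have "\<dots> \<le> u"
    using le_tau_iff_right by blast
  finally show "tau u \<le> u" .
qed

text \<open>By idempotence \<open>u * v\<close> absorbs \<open>u\<close> on the left and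
  \<open>v\<close> on the right, so both lie below its \<open>tau\<close>. Then so does
  \<open>v * u\<close>, which \<open>u * v\<close> therefore absorbs; positivity of
  \<open>u * v\<close> finishes.\<close>

lemma Sk_mult_le_commute:
  assumes "u \<in> Sk" "v \<in> Sk"
  shows "v * u \<le> u * v"
proof -
  let ?w = "u * v"
  have "v \<le> tau ?w"
    using assms by (simp add: le_tau_iff_right mult.assoc Sk_def)
  moreover have "u \<le> tau ?w"
    using assms by (simp add: le_tau_iff_left mult.assoc[symmetric] Sk_def)
  ultimately have "v * u \<le> tau ?w * tau ?w"
    by (rule mult_mono_rp)
  then have "?w * (v * u) \<le> ?w"
    using tau_in_Sk[of ?w] by (simp add: Sk_def le_tau_iff_right[symmetric])
  moreover have "v * u \<le> ?w * (v * u)"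
    using assms positive_mult[of u v] by (simp add: Sk_def positive_def)
  ultimately show ?thesis
    by (rule order_trans[rotated])
qed

lemma Sk_mult_commute: "u \<in> Sk \<Longrightarrow> v \<in> Sk \<Longrightarrow> u * v = v * u"
  by (simp add: Sk_mult_le_commute antisym)

lemma Sk_mult_closed:
  assumes "u \<in> Sk" "v \<in> Sk"
  shows "u * v \<in> Sk"
proof -
  have "(u * v) * (u * v) = u * (v * u) * v"
    by (simp add: mult.assoc)
  also have "\<dots> = u * (u * v) * v"
    using assms by (simp add: Sk_mult_commute)
  also have "\<dots> = (u * u) * (v * v)"
    by (simp add: mult.assoc)
  finally have "(u * v) * (u * v) = u * v"
    using assms by (simp add: Sk_def)
  moreover have "positive (u * v)"
    using assms by (simp add: Sk_def positive_mult)
  ultimately show ?thesis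
    by (simp add: Sk_def)
qed

lemma sk_join_eq_mult:
  assumes "u \<in> Sk" "v \<in> Sk"
  shows "sk_join u v = u * v"
  unfolding sk_join_def
proof (rule Least_equality)
  show "u * v \<in> Sk \<and> u \<le> u * v \<and> v \<le> u * v"
    using assms Sk_mult_closed by (auto simp: Sk_def positive_def)
next
  fix w assume "w \<in> Sk \<and> u \<le> w \<and> v \<le> w"
  then show "u * v \<le> w"
    using mult_mono_rp[of u w v w] by (simp add: Sk_def)
qed

section \<open>Stages of the coherentization as an increasing chain of partitions\<close>

lemma partition_on_merge:
  assumes P: "partition_on S P" and sym: "sym R" and R: "R \<subseteq> P \<times> P"
  shows "partition_on S {\<Union>{D. (C, D) \<in> R\<^sup>*} | C. C \<in> P}"
proof -
  have closed: "D \<in> P" if "(C, D) \<in> R\<^sup>*" "C \<in> P" for C D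
    using that R by (induction rule: rtrancl_induct) auto
  have symr: "(D, C) \<in> R\<^sup>*" if "(C, D) \<in> R\<^sup>*" for C D
    using that sym by (meson sym_rtrancl symD)
  show ?thesis
  proof (rule partition_onI)
    show "\<Union>{\<Union>{D. (C, D) \<in> R\<^sup>*} | C. C \<in> P} = S"
      using closed partition_onD1[OF P] by blast
  next
    have "\<Union>{D. (C, D) \<in> R\<^sup>*} \<noteq> {}" if "C \<in> P" for C
    proof -
      have "C \<noteq> {}"
        using that partition_onD3[OF P] by blast
      then show ?thesis
        by blast
    qed
    then show "{} \<notin> {\<Union>{D. (C, D) \<in> R\<^sup>*} | C. C \<in> P}"
      by (auto simp del: Union_empty_conv)
  next
    fix p q assume "p \<in> {\<Union>{D. (C, D) \<in> R\<^sup>*} | C. C \<in> P}"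
      "q \<in> {\<Union>{D. (C, D) \<in> R\<^sup>*} | C. C \<in> P}" and ne: "p \<noteq> q"
    then obtain C C' where C: "C \<in> P" "p = \<Union>{D. (C, D) \<in> R\<^sup>*}"
      and C': "C' \<in> P" "q = \<Union>{D. (C', D) \<in> R\<^sup>*}"
      by blast
    show "disjnt p q"
    proof (rule ccontr)
      assume "\<not> disjnt p q"
      then obtain z D D' where "z \<in> D" "(C, D) \<in> R\<^sup>*" "z \<in> D'" "(C', D') \<in> R\<^sup>*"
        unfolding C C' disjnt_def by blast
      \<comment> \<open>A point common to two merged blocks lies in a single original block, which
        connects the two components.\<close>
      moreover from this have "D = D'"
        using closed C(1) C'(1) partition_onD2[OF P] by (blast dest: disjointD)
      ultimately have "(C, C') \<in> R\<^sup>*" "(C', C) \<in> R\<^sup>*"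
        by (meson symr rtrancl_trans)+
      then have "p = q"
        unfolding C C' by (blast intro: rtrancl_trans)
      then show False
        using ne by blast
    qed
  qed
qed

lemma partition_on_CC_r:
  assumes "partition_on S \<Theta>"
  shows "partition_on S (CC_r \<Theta>)"
  unfolding CC_r_def
proof (rule partition_on_merge[OF assms])
  show "sym (block_graph \<Theta>)"
    unfolding block_graph_def sym_def by blast
  show "block_graph \<Theta> \<subseteq> \<Theta> \<times> \<Theta>"
    unfolding block_graph_def by blast
qed

lemma partition_on_Theta: "partition_on Sk (Theta n)"
proof (induction n)
  case 0
  show ?case
    by (auto simp: partition_on_def disjoint_def)
qed (simp add: partition_on_CC_r)

lemma block_equiv_CC_r: "block_equiv \<Theta> \<subseteq> block_equiv (CC_r \<Theta>)"
proof
  fix p assume "p \<in> block_equiv \<Theta>"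
  then obtain u v X where X: "p = (u, v)" "X \<in> \<Theta>" "u \<in> X" "v \<in> X"
    unfolding block_equiv_def by blast
  then have "X \<subseteq> \<Union>{D. (X, D) \<in> (block_graph \<Theta>)\<^sup>*}"
    by blast
  then show "p \<in> block_equiv (CC_r \<Theta>)"
    using X unfolding block_equiv_def CC_r_def by blast
qed

lemma mono_block_equiv_Theta: "m \<le> n \<Longrightarrow> block_equiv (Theta m) \<subseteq> block_equiv (Theta n)"
  by (rule lift_Suc_mono_le[of "\<lambda>n. block_equiv (Theta n)"]) (simp_all add: block_equiv_CC_r)

lemma equiv_block_equiv:
  assumes "partition_on S P"
  shows "equiv S (block_equiv P)"
  using equiv_partition_on[OF assms] by (simp add: block_equiv_def)

section \<open>The limit equivalence and its coherence\<close>

definition coherent_equiv :: "('a::balanced_residuated_posemigroup \<times> 'a) set" where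
  "coherent_equiv = (\<Union>n. block_equiv (Theta n))"

lemma residual_coherentization_eq: "residual_coherentization = Sk // coherent_equiv"
  by (simp add: residual_coherentization_def coherent_equiv_def)

text \<open>The stages increase, so the later of two stages serves both pairs. Transitivity and
  coherence of the limit both reduce to a single stage this way.\<close>

lemma coherent_equiv_common_stage:
  assumes "(u, v) \<in> coherent_equiv" "(u', v') \<in> coherent_equiv"
  obtains n where "(u, v) \<in> block_equiv (Theta n)" "(u', v') \<in> block_equiv (Theta n)"
proof -
  obtain m n where "(u, v) \<in> block_equiv (Theta m)" "(u', v') \<in> block_equiv (Theta n)"
    using assms unfolding coherent_equiv_def by blast
  then show ?thesis
    using that[of "max m n"] mono_block_equiv_Theta[of m "max m n"]
      mono_block_equiv_Theta[of n "max m n"] by auto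
qed

lemma equiv_coherent: "equiv Sk coherent_equiv"
proof (rule equivI)
  note eq = equiv_block_equiv[OF partition_on_Theta]
  show "coherent_equiv \<subseteq> Sk \<times> (Sk :: 'a set)"
    using equiv_type[OF eq] by (force simp: coherent_equiv_def)
  show "refl_on Sk (coherent_equiv :: ('a \<times> 'a) set)"
    using eq unfolding refl_on_def equiv_def coherent_equiv_def by blast
  show "sym (coherent_equiv :: ('a \<times> 'a) set)"
    unfolding block_equiv_def sym_def coherent_equiv_def by blast
  show "trans (coherent_equiv :: ('a \<times> 'a) set)"
  proof (rule transI)
    fix u v w :: 'a
    assume "(u, v) \<in> coherent_equiv" "(v, w) \<in> coherent_equiv"
    then obtain n where "(u, v) \<in> block_equiv (Theta n)" "(v, w) \<in> block_equiv (Theta n)"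
      by (rule coherent_equiv_common_stage)
    then have "(u, w) \<in> block_equiv (Theta n)"
      using eq by (meson equivE transD)
    then show "(u, w) \<in> coherent_equiv"
      unfolding coherent_equiv_def by blast
  qed
qed

lemma tau_star_merged:
  assumes part: "partition_on Sk \<Theta>" and "A \<in> \<Theta>" "B \<in> \<Theta>"
    and s: "s \<in> tau_star A B" and t: "t \<in> tau_star A B"
  shows "(s, t) \<in> block_equiv (CC_r \<Theta>)"
proof -
  have "tau_star A B \<subseteq> Sk"
    using tau_in_Sk by (auto simp: tau_star_def)
  then have "s \<in> \<Union>\<Theta>" "t \<in> \<Union>\<Theta>"
    using s t partition_onD1[OF part] by auto
  then obtain D E where D: "D \<in> \<Theta>" "s \<in> D" and E: "E \<in> \<Theta>" "t \<in> E"
    by auto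
  then have "D \<in> Out \<Theta> A B" "E \<in> Out \<Theta> A B"
    using s t by (auto simp: Out_def)
  then have "D \<noteq> E \<Longrightarrow> (D, E) \<in> block_graph \<Theta>"
    using assms(2,3) D(1) E(1) by (auto simp: block_graph_def)
  \<comment> \<open>Edges join distinct blocks only, so the case \<open>D = E\<close> is the empty
    path.\<close>
  then have "(D, E) \<in> (block_graph \<Theta>)\<^sup>*"
    by (cases "D = E") auto
  then have "s \<in> \<Union>{F. (D, F) \<in> (block_graph \<Theta>)\<^sup>*}"
    "t \<in> \<Union>{F. (D, F) \<in> (block_graph \<Theta>)\<^sup>*}"
    using D(2) E(2) by auto
  moreover have "\<Union>{F. (D, F) \<in> (block_graph \<Theta>)\<^sup>*} \<in> CC_r \<Theta>"
    using D(1) by (auto simp: CC_r_def)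
  ultimately show ?thesis
    unfolding block_equiv_def by (intro CollectI case_prodI bexI conjI)
qed

text \<open>Here \<open>s\<close> and \<open>t\<close> may come from different operations; this is
  what later allows a residual to be compared with a product.\<close>

lemma coherent_outputs:
  assumes "(tau x, tau x') \<in> coherent_equiv" "(tau y, tau y') \<in> coherent_equiv"
    and s: "s \<in> {tau (x * y), tau (lres x y), tau (rres x y)}"
    and t: "t \<in> {tau (x' * y'), tau (lres x' y'), tau (rres x' y')}"
  shows "(s, t) \<in> coherent_equiv"
proof -
  obtain n where "(tau x, tau x') \<in> block_equiv (Theta n)"
    "(tau y, tau y') \<in> block_equiv (Theta n)"
    using assms(1,2) by (rule coherent_equiv_common_stage)
  then obtain A B where A: "A \<in> Theta n" "x \<in> layer A" "x' \<in> layer A"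
    and B: "B \<in> Theta n" "y \<in> layer B" "y' \<in> layer B"
    unfolding block_equiv_def layer_def by blast
  have "s \<in> tau_star A B" "t \<in> tau_star A B"
    using s t A B unfolding tau_star_def by blast+
  then have "(s, t) \<in> block_equiv (Theta (Suc n))"
    using tau_star_merged[OF partition_on_Theta A(1) B(1)] by simp
  then show ?thesis
    unfolding coherent_equiv_def by blast
qed

text \<open>Since \<open>u\<close> and \<open>v\<close> are their own \<open>tau\<close>, they may
  replace \<open>x\<close> and \<open>y\<close>, and \<open>u * v\<close> is then one of the
  outputs. Output classes are thus computed by multiplying in \<open>Sk\<close>.\<close>

lemma coherent_outputs_mult_Sk:
  assumes "(u, tau x) \<in> coherent_equiv" "(v, tau y) \<in> coherent_equiv"
    and t: "t \<in> {tau (x * y), tau (lres x y), tau (rres x y)}"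
  shows "(u * v, t) \<in> coherent_equiv"
proof -
  have uv: "u \<in> Sk" "v \<in> Sk"
    using subsetD[OF equiv_type[OF equiv_coherent] assms(1)]
      subsetD[OF equiv_type[OF equiv_coherent] assms(2)] by simp_all
  then have "(tau u, tau x) \<in> coherent_equiv" "(tau v, tau y) \<in> coherent_equiv"
    using assms(1,2) by (simp_all add: tau_Sk)
  then have "(tau (u * v), t) \<in> coherent_equiv"
    using insertI1 t by (rule coherent_outputs)
  then show ?thesis
    using uv by (simp add: tau_Sk Sk_mult_closed)
qed

section \<open>Joins of blocks and the least product\<close>

lemma block_join_coherentization:
  assumes A: "A \<in> residual_coherentization" "u \<in> A"
    and B: "B \<in> residual_coherentization" "v \<in> B"
  shows "block_join residual_coherentization A B = coherent_equiv `` {u * v}"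
  unfolding block_join_def
proof (rule the_equality)
  note eq = equiv_coherent
  have Sk: "A \<subseteq> Sk" "B \<subseteq> Sk"
    using A B eq by (auto simp: residual_coherentization_eq intro: in_quotient_imp_subset[THEN subsetD])
  \<comment> \<open>Independence of representatives: \<open>a\<close> and \<open>b\<close> are
    related to \<open>u\<close> and \<open>v\<close>, so coherence relates \<open>a * b\<close>,
    their join, to \<open>u * v\<close>.\<close>
  have *: "(u * v, sk_join a b) \<in> coherent_equiv" if "a \<in> A" "b \<in> B" for a b
  proof -
    have ab: "a \<in> Sk" "b \<in> Sk"
      using that Sk by auto
    have "(u, tau a) \<in> coherent_equiv" "(v, tau b) \<in> coherent_equiv"
      using in_quotient_imp_in_rel[OF eq, of A u a] in_quotient_imp_in_rel[OF eq, of B v b]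
        A B that ab by (simp_all add: residual_coherentization_eq tau_Sk)
    then have "(u * v, tau (a * b)) \<in> coherent_equiv"
      by (rule coherent_outputs_mult_Sk) blast
    then show ?thesis
      using ab by (simp add: sk_join_eq_mult tau_Sk Sk_mult_closed)
  qed
  have uv: "u * v \<in> Sk"
    using A B Sk by (auto intro: Sk_mult_closed)
  have C: "coherent_equiv `` {u * v} \<in> residual_coherentization"
    using uv unfolding residual_coherentization_eq by (rule quotientI)
  with * show "coherent_equiv `` {u * v} \<in> residual_coherentization \<and>
      (\<forall>a\<in>A. \<forall>b\<in>B. sk_join a b \<in> coherent_equiv `` {u * v})"
    by blast
  fix D assume D: "D \<in> residual_coherentization \<and> (\<forall>a\<in>A. \<forall>b\<in>B. sk_join a b \<in> D)"
  \<comment> \<open>Uniqueness: \<open>D\<close> and the class of \<open>u * v\<close> share this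
    join, and classes that meet coincide.\<close>
  have "sk_join u v \<in> D" "sk_join u v \<in> coherent_equiv `` {u * v}"
    using D A B *[of u v] by blast+
  then show "D = coherent_equiv `` {u * v}"
    using quotient_disj[OF eq] D C unfolding residual_coherentization_eq by blast
qed

text \<open>The purely order-theoretic core: coherence is used only afterwards, to supply the
  membership of the stabiliser in \<open>C\<close>.\<close>

lemma mult_in_Pi_block:
  assumes C: "C \<subseteq> Sk" and r: "tau (lres x (x * y)) \<in> C"
  shows "x * y \<in> Pi_block C x y" and "\<forall>z\<in>Pi_block C x y. x * y \<le> z"
proof -
  show min: "\<forall>z\<in>Pi_block C x y. x * y \<le> z"
    using C by (auto simp: Pi_block_def Sk_def positive_def intro!: mult_mono_rp)
  \<comment> \<open>This is the largest right factor whose product with \<open>x\<close> stays below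
    \<open>x * y\<close>, so it lies above \<open>y\<close>.\<close>
  define y' where "y' = lres x (x * y)"
  let ?r = "tau y'"
  have "y \<le> y'"
    by (simp add: y'_def lres_galois[symmetric])
  then have "?r * (y * ?r) \<le> ?r * (y' * ?r)"
    by (intro mult_left_mono_rp mult_right_mono_rp)
  also have "\<dots> \<le> ?r * y'"
    by (intro mult_left_mono_rp) (simp add: le_tau_iff_right[symmetric])
  also have "\<dots> \<le> y'"
    by (simp add: le_tau_iff_left[symmetric])
  finally have "x * (?r * (y * ?r)) \<le> x * y"
    by (simp add: lres_galois y'_def)
  moreover have "(x * ?r) * (y * ?r) \<in> Pi_block C x y"
    using r by (auto simp: Pi_block_def y'_def)
  ultimately have "(x * ?r) * (y * ?r) = x * y"
    using min by (simp add: antisym mult.assoc)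
  with \<open>(x * ?r) * (y * ?r) \<in> Pi_block C x y\<close> show "x * y \<in> Pi_block C x y"
    by simp
qed

theorem proposition6p1:
  fixes \<Omega> :: "'a::balanced_residuated_posemigroup set set"
    and A B C :: "'a set" and x y :: 'a
  assumes "\<Omega> = residual_coherentization"
    and "A \<in> \<Omega>" and "B \<in> \<Omega>"
    and "x \<in> layer A" and "y \<in> layer B"
    and "C = block_join \<Omega> A B"
  shows "Pi_block C x y \<subseteq> layer C \<and>
    x * y \<in> Pi_block C x y \<and> (\<forall>z\<in>Pi_block C x y. x * y \<le> z)"
proof -
  let ?E = "coherent_equiv :: ('a \<times> 'a) set"
  define u v where "u = tau x" and "v = tau y"
  have Sk: "u \<in> Sk" "v \<in> Sk" "u * v \<in> Sk"
    by (simp_all add: u_def v_def tau_in_Sk Sk_mult_closed)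
  have C: "C = ?E `` {u * v}"
    using assms by (simp add: block_join_coherentization layer_def u_def v_def)
  have refl: "(w, w) \<in> ?E" if "w \<in> Sk" for w :: 'a
    using equiv_coherent that by (meson equivE refl_onD)
  have ux: "(u, tau x) \<in> ?E" and vy: "(v, tau y) \<in> ?E"
    using refl Sk by (simp_all only: u_def v_def)
  \<comment> \<open>These two absorption laws keep outputs in \<open>C\<close> when one argument has
    class \<open>C\<close> and the other is \<open>x\<close> or \<open>y\<close>.\<close>
  have uuv: "u * (u * v) = u * v"
    using Sk by (simp add: mult.assoc[symmetric] Sk_def)
  have vuv: "v * (u * v) = u * v"
    using Sk Sk_mult_commute[of v "u * v"] by (simp add: Sk_def mult.assoc)
  have CSk: "C \<subseteq> Sk"
    using equiv_type[OF equiv_coherent] unfolding C by blast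
  have xy: "(u * v, tau (x * y)) \<in> ?E"
    using coherent_outputs_mult_Sk[OF ux vy] by blast
  \<comment> \<open>Coherence is applied a second time, to the pair \<open>x\<close> and
    \<open>x * y\<close>; the class is that of \<open>u * (u * v)\<close>, again
    \<open>C\<close>.\<close>
  have "(u * v, tau (lres x (x * y))) \<in> ?E"
    using coherent_outputs_mult_Sk[OF ux xy] uuv by (metis insertCI)
  then have "tau (lres x (x * y)) \<in> C"
    unfolding C by blast
  note min = mult_in_Pi_block[OF CSk this]
  \<comment> \<open>Both factors have class \<open>C\<close> by absorption, and \<open>u * v\<close>
    is idempotent, so their product has class \<open>C\<close> too.\<close>
  have "(x * r) * (y * r) \<in> layer C" if "r \<in> C" for r
  proof -
    have r: "(u * v, tau r) \<in> ?E"
      using that CSk tau_Sk unfolding C by (metis Image_singleton_iff subsetD)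
    have "(u * v, tau (x * r)) \<in> ?E" "(u * v, tau (y * r)) \<in> ?E"
      using coherent_outputs_mult_Sk[OF ux r] coherent_outputs_mult_Sk[OF vy r] uuv vuv
      by (metis insertCI)+
    then have "((u * v) * (u * v), tau ((x * r) * (y * r))) \<in> ?E"
      by (rule coherent_outputs_mult_Sk) blast
    then show ?thesis
      using Sk unfolding C layer_def Sk_def by simp
  qed
  then have "Pi_block C x y \<subseteq> layer C"
    by (auto simp: Pi_block_def)
  with min show ?thesis
    by blast
qed

end
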